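(* If $f$ is a problem that is parallelizable (i.e., $f\equiv_{\mathrm W}\Pi f$) and stashable (i.e., $f\equiv_{\mathrm W}\Sigma f$), then $f$ is also closed under upper Turing cones, i.e., $f\equiv_{\mathrm W}f^{\mathcal D}$.
   Context: A represented space is a set $X$ with a partial surjective map $\delta_X:\subseteq\mathbb N^{\mathbb N}\to X$. A problem is a partial multi-valued function $f:\subseteq X\rightrightarrows Y$ between represented spaces that has a realizer; a realizer of $f$ is a function $F:\subseteq\mathbb N^{\mathbb N}\to\mathbb N^{\mathbb N}$ with $\delta_YF(p)\in f\delta_X(p)$ for all $p\in\mathrm{dom}(f\delta_X)$. For $p,q\in\mathbb N^{\mathbb N}$, $\langle p,q\rangle(2n)=p(n)$, $\langle p,q\rangle(2n+1)=q(n)$. For problems $f,g$: $f\leq_{\mathrm W}g$ if there are computable $H,K:\subseteq\mathbb N^{\mathbb N}\to\mathbb N^{\mathbb N}$ such that $H\langle\mathrm{id},GK\rangle$ is a realizer of $f$ whenever $G$ is a realizer of $g$; $f\equiv_{\mathrm W}g$ means $f\leq_{\mathrm W}g$ and $g\leq_{\mathrm W}f$. For a represented space $Y$, the completion $\overline Y:=Y\cup\{\bot\}$ ($\bot\notin Y$) is represented by the total map $\delta_{\overline Y}$ with $\delta_{\overline Y}(p)=\delta_Y(p-1)$ if $p-1\in\mathrm{dom}(\delta_Y)$ and $\delta_{\overline Y}(p)=\bot$ otherwise, where $p-1\in\mathbb N^{\mathbb N}\cup\mathbb N^*$ is the concatenation of $p(0)-1,p(1)-1,\dots$ and $0-1$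 is the empty word. $X^{\mathbb N}$ is represented by $\langle p_0,p_1,\dots\rangle\mapsto(\delta_X(p_n))_n$, where $\langle p_0,p_1,\dots\rangle\langle n,k\rangle:=p_n(k)$ and $\langle n,k\rangle:=\frac12(n+k)(n+k+1)+k$ for $n,k\in\mathbb N$. For $f:\subseteq X\rightrightarrows Y$: the parallelization $\Pi f:\subseteq X^{\mathbb N}\rightrightarrows Y^{\mathbb N}$ has domain $\mathrm{dom}(f)^{\mathbb N}$ and $\Pi f((x_n)_n)=\{(y_n)_n:(\forall n)\ y_n\in f(x_n)\}$; the stashing $\Sigma f:\subseteq X^{\mathbb N}\rightrightarrows\overline Y^{\mathbb N}$ has domain $\mathrm{dom}(f)^{\mathbb N}$ and $\Sigma f((x_n)_n)=\{(y_n)_n\in\overline Y^{\mathbb N}:(\exists n)\ y_n\in f(x_n)\}$. $\mathcal D$ is the set of Turing degrees $\deg_{\mathrm T}(p)=\{q\in\mathbb N^{\mathbb N}:q\equiv_{\mathrm T}p\}$, represented by $\delta_{\mathcal D}(p)=\deg_{\mathrm T}(p)$. For $y$ in a represented space $(Y,\delta_Y)$ and $q\in\mathbb N^{\mathbb N}$, $y\leq_{\mathrm T}q$ means that some name $p\in\delta_Y^{-1}\{y\}$ satisfies $p\leq_{\mathrm T}q$. The upper Turing cone version of $f:\subseteq X\rightrightarrows Y$ is $f^{\mathcal D}:\subseteq X\rightrightarrows\mathcal D$ with $\mathrm{dom}(f^{\mathcal D})=\mathrm{dom}(f)$ and $f^{\mathcal D}(x)=\{\deg_{\mathrm T}(q):(\exists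 y\leq_{\mathrm T}q)\ y\in f(x)\}$. *)

theory Defs
  imports Main "HOL-Library.Nat_Bijection" "HOL-Library.Infinite_Set"
begin

type_synonym baire = "nat \<Rightarrow> nat"

section \<open>Computability on Baire space\<close>

text \<open>Codes for the partial recursive functions of one natural number relative to an oracle:
  Kleene's basic functions, composition, primitive recursion and unbounded minimization, with
  several arguments packed into one number by the library pairing \<^const>\<open>prod_encode\<close>.\<close>

datatype code =
    Zero | Succ | Left | Right | Query
  | Pair code code | Comp code code | Prec code code | Mu code

definition pairing :: "(nat \<rightharpoonup> nat) \<Rightarrow> (nat \<rightharpoonup> nat) \<Rightarrow> (nat \<rightharpoonup> nat)" where
  "pairing f g x =
     (case f x of None \<Rightarrow> None
      | Some a \<Rightarrow> (case g x of None \<Rightarrow> None | Some b \<Rightarrow> Some (prod_encode (a, b))))"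

text \<open>\<open>h(a, 0) = f(a)\<close> and \<open>h(a, n + 1) = g(a, n, h(a, n))\<close>; undefinedness propagates.\<close>

fun prim_recursion :: "(nat \<rightharpoonup> nat) \<Rightarrow> (nat \<rightharpoonup> nat) \<Rightarrow> nat \<Rightarrow> nat \<Rightarrow> nat option" where
  "prim_recursion f g a 0 = f a"
| "prim_recursion f g a (Suc n) =
     (case prim_recursion f g a n of None \<Rightarrow> None
      | Some r \<Rightarrow> g (prod_encode (a, prod_encode (n, r))))"

text \<open>The least \<open>n\<close> with \<open>f(x, n) = 0\<close>, provided that \<open>f(x, m)\<close> is defined for all \<open>m < n\<close>.\<close>

definition is_mu :: "(nat \<rightharpoonup> nat) \<Rightarrow> nat \<Rightarrow> nat \<Rightarrow> bool" where
  "is_mu f x n \<longleftrightarrow> f (prod_encode (x, n)) = Some 0 \<and>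
     (\<forall>m<n. \<exists>v. f (prod_encode (x, m)) = Some v \<and> v \<noteq> 0)"

definition minimization :: "(nat \<rightharpoonup> nat) \<Rightarrow> (nat \<rightharpoonup> nat)" where
  "minimization f x = (if \<exists>n. is_mu f x n then Some (THE n. is_mu f x n) else None)"

primrec run :: "code \<Rightarrow> baire \<Rightarrow> (nat \<rightharpoonup> nat)" where
  "run Zero p = (\<lambda>x. Some 0)"
| "run Succ p = (\<lambda>x. Some (Suc x))"
| "run Left p = (\<lambda>x. Some (fst (prod_decode x)))"
| "run Right p = (\<lambda>x. Some (snd (prod_decode x)))"
| "run Query p = (\<lambda>x. Some (p x))"
| "run (Pair c d) p = pairing (run c p) (run d p)"
| "run (Comp c d) p = run c p \<circ>\<^sub>m run d p"
| "run (Prec c d) p =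
     (\<lambda>x. case prod_decode x of (a, n) \<Rightarrow> prim_recursion (run c p) (run d p) a n)"
| "run (Mu c) p = minimization (run c p)"

definition computes :: "code \<Rightarrow> baire \<Rightarrow> baire \<Rightarrow> bool" where
  "computes c p q \<longleftrightarrow> (\<forall>n. run c p n = Some (q n))"

text \<open>A machine for \<open>F\<close> has to be correct on the domain of \<open>F\<close>; outside of it, its behaviour
  is unconstrained.\<close>

definition computable :: "(baire \<rightharpoonup> baire) \<Rightarrow> bool" where
  "computable F \<longleftrightarrow> (\<exists>c. \<forall>p q. F p = Some q \<longrightarrow> computes c p q)"

definition turing_le :: "baire \<Rightarrow> baire \<Rightarrow> bool"  (infix \<open>\<le>\<^sub>T\<close> 50) where
  "p \<le>\<^sub>T q \<longleftrightarrow> (\<exists>c. computes c q p)"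

definition turing_equiv :: "baire \<Rightarrow> baire \<Rightarrow> bool"  (infix \<open>\<equiv>\<^sub>T\<close> 50) where
  "p \<equiv>\<^sub>T q \<longleftrightarrow> p \<le>\<^sub>T q \<and> q \<le>\<^sub>T p"

definition deg :: "baire \<Rightarrow> baire set" where
  "deg p = {q. q \<equiv>\<^sub>T p}"


section \<open>Represented spaces\<close>

text \<open>A represented space is given by its representation \<open>\<delta>\<close> alone: since representations are
  surjective, the underlying set is \<open>ran \<delta>\<close>.\<close>

type_synonym 'a rep = "baire \<rightharpoonup> 'a"

definition baire_pair :: "baire \<Rightarrow> baire \<Rightarrow> baire" where
  "baire_pair p q n = (if even n then p (n div 2) else q (n div 2))"

definition cantor_pair :: "nat \<Rightarrow> nat \<Rightarrow> nat" where
  "cantor_pair n k = ((n + k) * (n + k + 1)) div 2 + k"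

lemma cantor_pair_eq_prod_encode: "cantor_pair n k = prod_encode (k, n)"
  by (simp add: cantor_pair_def prod_encode_def triangle_def add.commute)

text \<open>The \<open>n\<close>-th component \<open>p\<^sub>n\<close> of \<open>p = \<langle>p\<^sub>0, p\<^sub>1, \<dots>\<rangle>\<close>.\<close>

definition component :: "baire \<Rightarrow> nat \<Rightarrow> baire" where
  "component p n = (\<lambda>k. p (cantor_pair n k))"

definition seq_rep :: "'a rep \<Rightarrow> (nat \<Rightarrow> 'a) rep" where
  "seq_rep \<delta> p =
     (if \<forall>n. component p n \<in> dom \<delta> then Some (\<lambda>n. the (\<delta> (component p n))) else None)"

datatype 'a completion = Bottom | Proper 'a

text \<open>\<open>p - 1\<close> drops the zeros of \<open>p\<close> and decrements the remaining entries. The result is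
  \<^const>\<open>None\<close> if it is only a finite word, which is never a name.\<close>

definition minus_one :: "baire \<Rightarrow> baire option" where
  "minus_one p =
     (if infinite {i. p i \<noteq> 0} then Some (\<lambda>n. p (enumerate {i. p i \<noteq> 0} n) - 1) else None)"

definition completion_rep :: "'a rep \<Rightarrow> 'a completion rep" where
  "completion_rep \<delta> p =
     Some (case (\<delta> \<circ>\<^sub>m minus_one) p of None \<Rightarrow> Bottom | Some y \<Rightarrow> Proper y)"

definition degree_rep :: "baire set rep" where
  "degree_rep p = Some (deg p)"

definition point_turing_le :: "'a rep \<Rightarrow> 'a \<Rightarrow> baire \<Rightarrow> bool" where
  "point_turing_le \<delta> y q \<longleftrightarrow> (\<exists>p. \<delta> p = Some y \<and> p \<le>\<^sub>T q)"


section \<open>Problems and Weihrauch reducibility\<close>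

text \<open>A partial multi-valued function between represented spaces; \<open>x\<close> lies outside of its
  domain iff its set of values at \<open>x\<close> is empty.\<close>

record ('a, 'b) mvfun =
  src :: "'a rep"
  tgt :: "'b rep"
  vals :: "'a \<Rightarrow> 'b set"

definition mv_dom :: "('a, 'b) mvfun \<Rightarrow> 'a set" where
  "mv_dom f = {x. vals f x \<noteq> {}}"

definition realizer :: "(baire \<rightharpoonup> baire) \<Rightarrow> ('a, 'b) mvfun \<Rightarrow> bool" where
  "realizer F f \<longleftrightarrow>
     (\<forall>p x. src f p = Some x \<and> x \<in> mv_dom f \<longrightarrow>
        (\<exists>y. (tgt f \<circ>\<^sub>m F) p = Some y \<and> y \<in> vals f x))"

definition is_problem :: "('a, 'b) mvfun \<Rightarrow> bool" where
  "is_problem f \<longleftrightarrow>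
     mv_dom f \<subseteq> ran (src f) \<and> (\<forall>x. vals f x \<subseteq> ran (tgt f)) \<and> (\<exists>F. realizer F f)"

definition weihrauch_le :: "('a, 'b) mvfun \<Rightarrow> ('c, 'd) mvfun \<Rightarrow> bool"  (infix \<open>\<le>\<^sub>W\<close> 50) where
  "f \<le>\<^sub>W g \<longleftrightarrow>
     (\<exists>H K. computable H \<and> computable K \<and>
        (\<forall>G. realizer G g \<longrightarrow>
           realizer (H \<circ>\<^sub>m (\<lambda>p. map_option (baire_pair p) ((G \<circ>\<^sub>m K) p))) f))"

definition weihrauch_equiv :: "('a, 'b) mvfun \<Rightarrow> ('c, 'd) mvfun \<Rightarrow> bool"  (infix \<open>\<equiv>\<^sub>W\<close> 50) where
  "f \<equiv>\<^sub>W g \<longleftrightarrow> f \<le>\<^sub>W g \<and> g \<le>\<^sub>W f"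

definition parallelization :: "('a, 'b) mvfun \<Rightarrow> (nat \<Rightarrow> 'a, nat \<Rightarrow> 'b) mvfun" where
  "parallelization f =
     \<lparr> src = seq_rep (src f),
       tgt = seq_rep (tgt f),
       vals = (\<lambda>x. {y. \<forall>n. y n \<in> vals f (x n)}) \<rparr>"

definition stashing :: "('a, 'b) mvfun \<Rightarrow> (nat \<Rightarrow> 'a, nat \<Rightarrow> 'b completion) mvfun" where
  "stashing f =
     \<lparr> src = seq_rep (src f),
       tgt = seq_rep (completion_rep (tgt f)),
       vals = (\<lambda>x. {y. (\<forall>n. x n \<in> mv_dom f) \<and>
                       (\<forall>n. y n \<in> ran (completion_rep (tgt f))) \<and>
                       (\<exists>n. y n \<in> Proper ` vals f (x n))}) \<rparr>"

definition upper_cone :: "('a, 'b) mvfun \<Rightarrow> ('a, baire set) mvfun" where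
  "upper_cone f =
     \<lparr> src = src f,
       tgt = degree_rep,
       vals = (\<lambda>x. {deg q | q. \<exists>y. point_turing_le (tgt f) y q \<and> y \<in> vals f x}) \<rparr>"

lemma turing_le_refl: "p \<le>\<^sub>T p"
  by (auto simp: turing_le_def computes_def intro!: exI[of _ Query])

lemma mv_dom_parallelization: "mv_dom (parallelization f) = {x. \<forall>n. x n \<in> mv_dom f}"
proof -
  have "(\<exists>y. \<forall>n. y n \<in> vals f (x n)) \<longleftrightarrow> (\<forall>n. \<exists>y. y \<in> vals f (x n))" for x
    by metis
  then show ?thesis
    by (intro set_eqI) (simp add: mv_dom_def parallelization_def ex_in_conv[symmetric] del: ex_in_conv)
qed

lemma mv_dom_stashing:
  assumes "is_problem f"
  shows "mv_dom (stashing f) = {x. \<forall>n. x n \<in> mv_dom f}"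
proof -
  have "\<exists>y. y \<in> vals (stashing f) x" if x: "\<forall>n. x n \<in> mv_dom f" for x
  proof -
    obtain y where y: "y \<in> vals f (x 0)"
      using x by (auto simp: mv_dom_def)
    with assms obtain p where p: "tgt f p = Some y"
      unfolding is_problem_def ran_def by blast
    have "enumerate UNIV n = n" for n :: nat
      by (induction n) (auto simp: enumerate_0 enumerate_Suc'' intro!: Least_equality)
    then have "minus_one (\<lambda>n. Suc (p n)) = Some p"
      by (simp add: minus_one_def)
    with p have "completion_rep (tgt f) (\<lambda>n. Suc (p n)) = Some (Proper y)"
      by (simp add: completion_rep_def)
    then have "Proper y \<in> ran (completion_rep (tgt f))"
      by (auto simp: ran_def)
    with x y have "(\<lambda>n. Proper y) \<in> vals (stashing f) x"
      by (auto simp: stashing_def)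
    then show ?thesis by blast
  qed
  moreover have "\<forall>n. x n \<in> mv_dom f" if "y \<in> vals (stashing f) x" for x y
    using that by (simp add: stashing_def)
  ultimately show ?thesis
    unfolding mv_dom_def[of "stashing f"] by blast
qed

lemma mv_dom_upper_cone:
  assumes "is_problem f"
  shows "mv_dom (upper_cone f) = mv_dom f"
proof -
  have "\<exists>q. point_turing_le (tgt f) y q" if "y \<in> vals f x" for x y
    using assms that turing_le_refl unfolding is_problem_def ran_def point_turing_le_def by blast
  then show ?thesis
    by (fastforce simp: mv_dom_def upper_cone_def)
qed

end

theory Submission imports Defs
begin

text \<open>A name of a value \<open>y\<close> of \<open>f\<close> computes itself, so \<open>f\<^sup>D \<le>\<^sub>W f\<close>. Conversely it suffices to reduce the
  stashing of \<open>f\<close> to \<open>f\<^sup>D\<close>. Parallelizability turns an instance \<open>(x\<^sub>n)\<^sub>n\<close> into a single instance of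
  \<open>f\<close>; applying \<open>f\<^sup>D\<close> to it gives some \<open>q\<close> that computes, together with the input, a name of a
  sequence of solutions of all \<open>x\<^sub>n\<close>, but the program is unknown. So in the \<open>n\<close>-th place we guess
  that the \<open>n\<close>-th program is the right one and output the \<open>n\<close>-th component of what it computes,
  delayed by zeros while it is running. The guess is right for some \<open>n\<close>, and stashing asks for no
  more than that.\<close>

section \<open>Closure properties of relative computability\<close>

text \<open>One code serves all oracles in \<open>S\<close>. Taking \<open>S = UNIV\<close> gives
  uniformly computable functionals and \<open>S = {p}\<close> gives Turing reducibility to
  \<open>p\<close>, so the closure rules are proved once for both.\<close>

definition computable_on :: "baire set \<Rightarrow> (baire \<Rightarrow> nat \<Rightarrow> nat) \<Rightarrow> bool" where
  "computable_on S F \<longleftrightarrow> (\<exists>c. \<forall>p\<in>S. computes c p (F p))"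

lemma computable_on_singleton: "computable_on {p} F \<longleftrightarrow> F p \<le>\<^sub>T p"
  by (simp add: computable_on_def turing_le_def)

named_theorems computable_intros

lemma computable_on_comp:
  assumes "computable_on S F" "computable_on S G"
  shows "computable_on S (\<lambda>p x. F p (G p x))"
proof -
  obtain c d where "\<forall>p\<in>S. computes c p (F p)" "\<forall>p\<in>S. computes d p (G p)"
    using assms by (auto simp: computable_on_def)
  then have "\<forall>p\<in>S. computes (Comp c d) p (\<lambda>x. F p (G p x))"
    by (simp add: computes_def)
  then show ?thesis
    unfolding computable_on_def by blast
qed

lemma computable_on_prod_encode [computable_intros]:
  assumes "computable_on S F" "computable_on S G"
  shows "computable_on S (\<lambda>p x. prod_encode (F p x, G p x))"
proof -
  obtain c d where "\<forall>p\<in>S. computes c p (F p)" "\<forall>p\<in>S. computes d p (G p)"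
    using assms by (auto simp: computable_on_def)
  then have "\<forall>p\<in>S. computes (Pair c d) p (\<lambda>x. prod_encode (F p x, G p x))"
    by (simp add: computes_def pairing_def)
  then show ?thesis
    unfolding computable_on_def by blast
qed

lemma computable_on_fst [computable_intros]:
  assumes "computable_on S F"
  shows "computable_on S (\<lambda>p x. fst (prod_decode (F p x)))"
proof -
  have "computable_on S (\<lambda>p x. fst (prod_decode x))"
    by (auto simp: computable_on_def computes_def intro!: exI[of _ Left])
  from computable_on_comp[OF this assms] show ?thesis .
qed

lemma computable_on_snd [computable_intros]:
  assumes "computable_on S F"
  shows "computable_on S (\<lambda>p x. snd (prod_decode (F p x)))"
proof -
  have "computable_on S (\<lambda>p x. snd (prod_decode x))"
    by (auto simp: computable_on_def computes_def intro!: exI[of _ Right])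
  from computable_on_comp[OF this assms] show ?thesis .
qed

lemma computable_on_Suc [computable_intros]:
  assumes "computable_on S F"
  shows "computable_on S (\<lambda>p x. Suc (F p x))"
proof -
  have "computable_on S (\<lambda>p x. Suc x)"
    by (auto simp: computable_on_def computes_def intro!: exI[of _ Succ])
  from computable_on_comp[OF this assms] show ?thesis .
qed

lemma computable_on_oracle [computable_intros]:
  assumes "computable_on S F"
  shows "computable_on S (\<lambda>p x. p (F p x))"
proof -
  have "computable_on S (\<lambda>p x. p x)"
    by (auto simp: computable_on_def computes_def intro!: exI[of _ Query])
  from computable_on_comp[OF this assms] show ?thesis .
qed

lemma computable_on_ident [computable_intros]: "computable_on S (\<lambda>p x. x)"
  \<comment> \<open>\<open>code\<close> has no identity; pairing the two projections supplies
    it.\<close>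
  by (auto simp: computable_on_def computes_def pairing_def intro!: exI[of _ "Pair Left Right"])

lemma computable_on_const [computable_intros]: "computable_on S (\<lambda>p x. k)"
proof (induction k)
  case 0
  show ?case
    by (auto simp: computable_on_def computes_def intro!: exI[of _ Zero])
next
  case (Suc k)
  then show ?case
    by (rule computable_on_Suc)
qed

text \<open>\<open>Prec\<close> takes parameter and counter packed together, so it is composed with
  a code that sends \<open>x\<close> to the pair of \<open>x\<close> and
  \<open>N p x\<close>.\<close>

lemma computable_on_rec_nat:
  assumes "computable_on S B" "computable_on S G" "computable_on S N"
  shows "computable_on S
    (\<lambda>p x. rec_nat (B p x) (\<lambda>i r. G p (prod_encode (x, prod_encode (i, r)))) (N p x))"
proof -
  obtain b g m where c: "\<forall>p\<in>S. computes b p (B p)" "\<forall>p\<in>S. computes g p (G p)"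
      "\<forall>p\<in>S. computes m p (N p)"
    using assms by (auto simp: computable_on_def)
  have "prim_recursion (run b p) (run g p) x n =
      Some (rec_nat (B p x) (\<lambda>i r. G p (prod_encode (x, prod_encode (i, r)))) n)"
    if "p \<in> S" for p x n
    using c that by (induction n) (auto simp: computes_def)
  then have "\<forall>p\<in>S. computes (Comp (Prec b g) (Pair (Pair Left Right) m)) p
      (\<lambda>x. rec_nat (B p x) (\<lambda>i r. G p (prod_encode (x, prod_encode (i, r)))) (N p x))"
    using c by (simp add: computes_def pairing_def)
  then show ?thesis
    unfolding computable_on_def by blast
qed

lemma computable_on_funpow [computable_intros]:
  assumes "computable_on S F" "computable_on S N" "computable_on S B"
  shows "computable_on S (\<lambda>p x. (F p ^^ N p x) (B p x))"
proof -
  have "computable_on S (\<lambda>p z. F p (snd (prod_decode (snd (prod_decode z)))))"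
    by (intro computable_on_comp[OF assms(1)] computable_intros)
  from computable_on_rec_nat[OF assms(3) this assms(2)]
  have "computable_on S (\<lambda>p x. rec_nat (B p x) (\<lambda>i r. F p r) (N p x))"
    by simp
  moreover have "rec_nat b (\<lambda>i r. g r) n = (g ^^ n) b" for b n and g :: "nat \<Rightarrow> nat"
    by (induction n) auto
  ultimately show ?thesis
    by simp
qed

lemma computable_on_pred:
  assumes "computable_on S F"
  shows "computable_on S (\<lambda>p x. F p x - 1)"
proof -
  have "computable_on S (\<lambda>p x. rec_nat 0
      (\<lambda>i r. fst (prod_decode (snd (prod_decode (prod_encode (x, prod_encode (i, r))))))) (F p x))"
    by (intro computable_on_rec_nat computable_intros assms)
  moreover have "rec_nat 0 (\<lambda>i r. i) n = n - 1" for n :: nat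
    by (cases n) auto
  ultimately show ?thesis
    by simp
qed

lemma computable_on_diff [computable_intros]:
  assumes "computable_on S F" "computable_on S G"
  shows "computable_on S (\<lambda>p x. F p x - G p x)"
proof -
  have "computable_on S (\<lambda>p x. ((\<lambda>r. r - 1) ^^ G p x) (F p x))"
    by (intro computable_on_funpow computable_on_pred computable_intros assms)
  moreover have "((\<lambda>r. r - 1) ^^ n) m = m - n" for m n :: nat
    by (induction n) auto
  ultimately show ?thesis
    by simp
qed

text \<open>Primitive recursion whose step ignores the previous value. Both branches are total, so
  computing \<open>A\<close> first does no harm.\<close>

lemma computable_on_if_zero:
  assumes "computable_on S N" "computable_on S A" "computable_on S B"
  shows "computable_on S (\<lambda>p x. if N p x = 0 then A p x else B p x)"
proof -
  have "computable_on S (\<lambda>p z. B p (fst (prod_decode z)))"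
    by (intro computable_on_comp[OF assms(3)] computable_intros)
  from computable_on_rec_nat[OF assms(2) this assms(1)]
  have "computable_on S (\<lambda>p x. rec_nat (A p x) (\<lambda>i r. B p x) (N p x))"
    by simp
  moreover have "rec_nat a (\<lambda>i r. b) n = (if n = 0 then a else b)" for a b n :: nat
    by (cases n) auto
  ultimately show ?thesis
    by simp
qed

lemma computable_on_if_eq [computable_intros]:
  assumes "computable_on S M" "computable_on S N" "computable_on S A" "computable_on S B"
  shows "computable_on S (\<lambda>p x. if M p x = N p x then A p x else B p x)"
proof -
  have "computable_on S (\<lambda>p x. if M p x - N p x = 0 then
      if N p x - M p x = 0 then A p x else B p x else B p x)"
    by (intro computable_on_if_zero computable_on_diff assms)
  moreover have "(if m - n = 0 then if n - m = 0 then a else b else b) = (if m = n then a else b)"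
    for m n a b :: nat by auto
  ultimately show ?thesis
    by simp
qed

lemma computable_on_double [computable_intros]:
  assumes "computable_on S F"
  shows "computable_on S (\<lambda>p x. 2 * F p x)"
proof -
  have "computable_on S (\<lambda>p x. ((\<lambda>r. Suc (Suc r)) ^^ F p x) 0)"
    by (intro computable_intros assms)
  moreover have "((\<lambda>r. Suc (Suc r)) ^^ n) 0 = 2 * n" for n
    by (induction n) auto
  ultimately show ?thesis
    by simp
qed

lemma computable_on_mod_2 [computable_intros]:
  assumes "computable_on S F"
  shows "computable_on S (\<lambda>p x. F p x mod 2)"
proof -
  have "computable_on S (\<lambda>p x. ((\<lambda>r. 1 - r) ^^ F p x) 0)"
    by (intro computable_intros assms)
  moreover have "((\<lambda>r. 1 - r) ^^ n) 0 = n mod 2" for n :: nat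
    by (induction n) (auto simp: mod_Suc)
  ultimately show ?thesis
    by simp
qed

lemma computable_on_div_2 [computable_intros]:
  assumes "computable_on S F"
  shows "computable_on S (\<lambda>p x. F p x div 2)"
proof -
  let ?i = "\<lambda>z. fst (prod_decode (snd (prod_decode z)))"
  let ?r = "\<lambda>z. snd (prod_decode (snd (prod_decode z)))"
  \<comment> \<open>The recursion counts the odd numbers below its argument.\<close>
  have "computable_on S (\<lambda>p z. if ?i z mod 2 = 0 then ?r z else Suc (?r z))"
    by (intro computable_intros)
  from computable_on_rec_nat[OF computable_on_const this assms, of 0]
  have "computable_on S (\<lambda>p x. rec_nat 0 (\<lambda>i r. if i mod 2 = 0 then r else Suc r) (F p x))"
    by (simp cong: if_cong)
  moreover have "rec_nat 0 (\<lambda>i r. if i mod 2 = 0 then r else Suc r) n = n div 2" for n :: nat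
    by (induction n) (auto, presburger+)
  ultimately show ?thesis
    by simp
qed

lemma computable_on_baire_pair:
  assumes "computable_on S F" "computable_on S G"
  shows "computable_on S (\<lambda>p. baire_pair (F p) (G p))"
proof -
  have "computable_on S (\<lambda>p x. if x mod 2 = 0 then F p (x div 2) else G p (x div 2))"
    by (intro computable_intros assms[THEN computable_on_comp])
  moreover have "baire_pair q r = (\<lambda>x. if x mod 2 = 0 then q (x div 2) else r (x div 2))" for q r
    by (auto simp: baire_pair_def even_iff_mod_2_eq_zero)
  ultimately show ?thesis
    by simp
qed

section \<open>Substitution for the oracle and Turing reducibility\<close>

primrec subst_oracle :: "code \<Rightarrow> code \<Rightarrow> code" where
  "subst_oracle d Zero = Zero"
| "subst_oracle d Succ = Succ"
| "subst_oracle d Left = Left"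
| "subst_oracle d Right = Right"
| "subst_oracle d Query = d"
| "subst_oracle d (Pair a b) = Pair (subst_oracle d a) (subst_oracle d b)"
| "subst_oracle d (Comp a b) = Comp (subst_oracle d a) (subst_oracle d b)"
| "subst_oracle d (Prec a b) = Prec (subst_oracle d a) (subst_oracle d b)"
| "subst_oracle d (Mu a) = Mu (subst_oracle d a)"

text \<open>The oracle enters only through \<open>Query\<close>, and \<open>d\<close> answers each
  such call with the right value. Hence relative computations compose.\<close>

lemma run_subst_oracle:
  assumes "computes d p q"
  shows "run (subst_oracle d c) p = run c q"
  using assms by (induction c) (auto simp: computes_def)

lemma turing_le_trans:
  assumes "p \<le>\<^sub>T q" "q \<le>\<^sub>T r"
  shows "p \<le>\<^sub>T r"
  using assms run_subst_oracle unfolding turing_le_def computes_def by metis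

lemma turing_le_baire_pair:
  assumes "p \<le>\<^sub>T r" "q \<le>\<^sub>T r"
  shows "baire_pair p q \<le>\<^sub>T r"
  using computable_on_baire_pair[of "{r}" "\<lambda>_. p" "\<lambda>_. q"] assms
  by (simp add: computable_on_singleton)

lemma baire_pair_left: "baire_pair p q (2 * n) = p n"
  and baire_pair_right: "baire_pair p q (Suc (2 * n)) = q n"
  by (simp_all add: baire_pair_def)

lemma turing_le_baire_pair_left: "p \<le>\<^sub>T baire_pair p q"
proof -
  have "computable_on {baire_pair p q} (\<lambda>r n. r (2 * n))"
    by (intro computable_intros)
  then show ?thesis
    by (simp add: computable_on_singleton baire_pair_left)
qed

lemma turing_le_baire_pair_right: "q \<le>\<^sub>T baire_pair p q"
proof -
  have "computable_on {baire_pair p q} (\<lambda>r n. r (Suc (2 * n)))"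
    by (intro computable_intros)
  then show ?thesis
    by (simp add: computable_on_singleton baire_pair_right)
qed

lemma computable_Some: "computable (\<lambda>p. Some (F p)) \<longleftrightarrow> computable_on UNIV F"
  by (simp add: computable_def computable_on_def)

lemma computable_map_comp:
  assumes "computable F" "computable G"
  shows "computable (F \<circ>\<^sub>m G)"
proof -
  obtain c d where c: "\<And>p q. F p = Some q \<Longrightarrow> computes c p q"
    and d: "\<And>p q. G p = Some q \<Longrightarrow> computes d p q"
    using assms by (auto simp: computable_def)
  have "computes (subst_oracle d c) p q" if "(F \<circ>\<^sub>m G) p = Some q" for p q
    using that c run_subst_oracle[OF d] by (fastforce simp: map_comp_Some_iff computes_def)
  then show ?thesis
    by (auto simp: computable_def)
qed

lemma computable_imp_turing_le:
  assumes "computable F" "F p = Some q"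
  shows "q \<le>\<^sub>T p"
  using assms by (auto simp: computable_def turing_le_def)


section \<open>A stack machine interpreting codes\<close>

text \<open>A state \<open>(v, stack)\<close> consists of a value and a stack of tagged instructions. The tags
  9 to 12 belong to the continuations of pairing (two), primitive recursion and minimization.\<close>

definition push :: "nat \<times> nat \<Rightarrow> nat \<Rightarrow> nat" where
  "push i k = Suc (prod_encode (prod_encode i, k))"

primrec code_encode :: "code \<Rightarrow> nat" where
  "code_encode Zero = prod_encode (0, 0)"
| "code_encode Succ = prod_encode (1, 0)"
| "code_encode Left = prod_encode (2, 0)"
| "code_encode Right = prod_encode (3, 0)"
| "code_encode Query = prod_encode (4, 0)"
| "code_encode (Pair c d) = prod_encode (5, prod_encode (code_encode c, code_encode d))"
| "code_encode (Comp c d) = prod_encode (6, prod_encode (code_encode c, code_encode d))"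
| "code_encode (Prec c d) = prod_encode (7, prod_encode (code_encode c, code_encode d))"
| "code_encode (Mu c) = prod_encode (8, code_encode c)"

text \<open>The value \<open>v\<close> is both the last result and the argument of the top
  instruction. Tags 0 to 8 are those of \<open>code_encode\<close>, so codes lie on the stack
  directly. Tag 9 saves the second code and the argument, 10 the first result, 11 the step code with
  parameter, counter and bound, 12 the code with argument and candidate. An empty stack makes the
  state a fixed point.\<close>

definition step :: "baire \<Rightarrow> nat \<Rightarrow> nat" where
  "step p s =
    (let v = fst (prod_decode s); stack = snd (prod_decode s) in
     if stack = 0 then s else
     let i = fst (prod_decode (stack - 1)); k = snd (prod_decode (stack - 1));
       t = fst (prod_decode i); a = snd (prod_decode i);
       b = fst (prod_decode a); c = snd (prod_decode a);
       d = fst (prod_decode c); e = snd (prod_decode c)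
     in
       if t = 0 then prod_encode (0, k)
       else if t = 1 then prod_encode (Suc v, k)
       else if t = 2 then prod_encode (fst (prod_decode v), k)
       else if t = 3 then prod_encode (snd (prod_decode v), k)
       else if t = 4 then prod_encode (p v, k)
       else if t = 5 then
         prod_encode (v, Suc (prod_encode (b, push (9, prod_encode (c, v)) k)))
       else if t = 6 then prod_encode (v, Suc (prod_encode (c, Suc (prod_encode (b, k)))))
       else if t = 7 then
         prod_encode (fst (prod_decode v), Suc (prod_encode (b,
           push (11, prod_encode (c, prod_encode (fst (prod_decode v),
             prod_encode (0, snd (prod_decode v))))) k)))
       else if t = 8 then
         prod_encode (prod_encode (v, 0), Suc (prod_encode (a,
           push (12, prod_encode (a, prod_encode (v, 0))) k)))
       else if t = 9 then prod_encode (c, Suc (prod_encode (b, push (10, v) k)))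
       else if t = 10 then prod_encode (prod_encode (a, v), k)
       else if t = 11 then
         if fst (prod_decode e) = snd (prod_decode e) then prod_encode (v, k)
         else prod_encode (prod_encode (d, prod_encode (fst (prod_decode e), v)),
           Suc (prod_encode (b, push (11, prod_encode (b, prod_encode (d,
             prod_encode (Suc (fst (prod_decode e)), snd (prod_decode e))))) k)))
       else
         if v = 0 then prod_encode (e, k)
         else prod_encode (prod_encode (d, Suc e), Suc (prod_encode (b,
           push (12, prod_encode (b, prod_encode (d, Suc e))) k))))"

lemma computable_on_step: "computable_on S step"
proof -
  have "computable_on S (\<lambda>p s. step p s)"
    unfolding step_def Let_def push_def by (intro computable_intros)
  then show ?thesis
    by simp
qed

section \<open>Correctness of the interpreter\<close>

definition reaches :: "baire \<Rightarrow> nat \<Rightarrow> nat \<Rightarrow> bool" where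
  "reaches p s s' \<longleftrightarrow> (\<exists>t. (step p ^^ t) s = s')"

lemma reaches_trans:
  assumes "reaches p s s'" "reaches p s' s''"
  shows "reaches p s s''"
proof -
  obtain t t' where "(step p ^^ t) s = s'" "(step p ^^ t') s' = s''"
    using assms by (auto simp: reaches_def)
  then have "(step p ^^ (t' + t)) s = s''"
    by (simp add: funpow_add)
  then show ?thesis
    unfolding reaches_def by blast
qed

lemma reaches_step:
  assumes "reaches p (step p s) s'"
  shows "reaches p s s'"
  using reaches_trans[OF _ assms] by (metis reaches_def funpow_0 funpow.simps(2) comp_apply)

lemma reaches_refl: "reaches p s s"
  by (auto simp: reaches_def intro!: exI[of _ 0])

lemma is_mu_unique:
  assumes "is_mu f x m" "is_mu f x n"
  shows "m = n"
  using assms unfolding is_mu_def by (metis linorder_neqE_nat option.inject)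

text \<open>Induction over the code. The rest \<open>k\<close> of the stack stays arbitrary, since a
  subprogram runs on top of the continuation of its caller.\<close>

lemma reaches_run:
  "run c p x = Some y \<Longrightarrow>
    reaches p (prod_encode (x, Suc (prod_encode (code_encode c, k)))) (prod_encode (y, k))"
proof (induction c arbitrary: x y k)
  case (Pair c d)
  then obtain a b where a: "run c p x = Some a" and b: "run d p x = Some b"
    and y: "y = prod_encode (a, b)"
    by (auto simp: pairing_def split: option.splits)
  show ?case
    apply (rule reaches_step, simp add: step_def push_def)
    apply (rule reaches_trans[OF Pair.IH(1)[OF a]])
    apply (rule reaches_step, simp add: step_def push_def)
    apply (rule reaches_trans[OF Pair.IH(2)[OF b]])
    apply (rule reaches_step, simp add: step_def push_def y reaches_refl)
    done
next
  case (Comp c d)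
  then obtain a where a: "run d p x = Some a" and y: "run c p a = Some y"
    by (auto simp: map_comp_Some_iff)
  show ?case
    apply (rule reaches_step, simp add: step_def)
    apply (rule reaches_trans[OF Comp.IH(2)[OF a]])
    apply (rule Comp.IH(1)[OF y])
    done
next
  case (Prec c d)
  obtain a N where x: "x = prod_encode (a, N)"
    by (metis prod_decode_inverse surj_pair)
  \<comment> \<open>The record kept after \<open>n\<close> rounds. The invariant below puts the
    intermediate result on top of it; the loop gets that far because the counter differs from the
    bound \<open>N\<close> in all earlier rounds.\<close>
  let ?R = "\<lambda>n. prod_encode (code_encode d, prod_encode (a, prod_encode (n, N)))"
  have "reaches p (prod_encode (x, Suc (prod_encode (code_encode (Prec c d), k))))
      (prod_encode (r, push (11, ?R n) k))"
    if "prim_recursion (run c p) (run d p) a n = Some r" "n \<le> N" for n r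
    using that
  proof (induction n arbitrary: r)
    case 0
    then show ?case
      by - (rule reaches_step, simp add: step_def x Prec.IH(1))
  next
    case (Suc n)
    then obtain r' where r': "prim_recursion (run c p) (run d p) a n = Some r'"
      and r: "run d p (prod_encode (a, prod_encode (n, r'))) = Some r"
      by (auto split: option.splits)
    have "reaches p (prod_encode (r', push (11, ?R n) k)) (prod_encode (r, push (11, ?R (Suc n)) k))"
      apply (rule reaches_step)
      using Suc.prems(2) Prec.IH(2)[OF r] by (simp add: step_def push_def Let_def)
    moreover have "reaches p (prod_encode (x, Suc (prod_encode (code_encode (Prec c d), k))))
        (prod_encode (r', push (11, ?R n) k))"
      using Suc.IH[OF r'] Suc.prems(2) by simp
    ultimately show ?case
      by (blast intro: reaches_trans)
  qed
  moreover have "reaches p (prod_encode (y, push (11, ?R N) k)) (prod_encode (y, k))"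
    by (rule reaches_step) (simp add: step_def push_def reaches_refl)
  moreover have "prim_recursion (run c p) (run d p) a N = Some y"
    using Prec.prems by (simp add: x)
  ultimately show ?case
    using reaches_trans by blast
next
  case (Mu c)
  then have "\<exists>n. is_mu (run c p) x n"
    by (auto simp: minimization_def split: if_splits)
  then have mu: "is_mu (run c p) x y"
    using Mu.prems is_mu_unique by (auto simp: minimization_def intro!: theI2[of "is_mu (run c p) x"])
  let ?M = "\<lambda>m. push (12, prod_encode (code_encode c, prod_encode (x, m))) k"
  \<comment> \<open>The search arrives at every candidate \<open>m \<le> y\<close>, because the
    smaller ones give nonzero values.\<close>
  have "reaches p (prod_encode (x, Suc (prod_encode (code_encode (Mu c), k))))
      (prod_encode (prod_encode (x, m), Suc (prod_encode (code_encode c, ?M m))))"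
    if "m \<le> y" for m
    using that
  proof (induction m)
    case 0
    show ?case
      by (rule reaches_step) (simp add: step_def Let_def reaches_refl)
  next
    case (Suc m)
    then obtain v where v: "run c p (prod_encode (x, m)) = Some v" "v \<noteq> 0"
      using mu by (auto simp: is_mu_def Suc_le_eq)
    have "reaches p (prod_encode (v, ?M m))
        (prod_encode (prod_encode (x, Suc m), Suc (prod_encode (code_encode c, ?M (Suc m)))))"
      by (rule reaches_step) (simp add: step_def push_def Let_def reaches_refl v)
    moreover have "reaches p (prod_encode (x, Suc (prod_encode (code_encode (Mu c), k))))
        (prod_encode (prod_encode (x, m), Suc (prod_encode (code_encode c, ?M m))))"
      using Suc by simp
    ultimately show ?case
      using Mu.IH[OF v(1)] by (blast intro: reaches_trans)
  qed
  moreover have "reaches p (prod_encode (prod_encode (x, y), Suc (prod_encode (code_encode c, ?M y))))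
      (prod_encode (0, ?M y))"
    using mu by (intro Mu.IH) (simp add: is_mu_def)
  moreover have "reaches p (prod_encode (0, ?M y)) (prod_encode (y, k))"
    by (rule reaches_step) (simp add: step_def push_def reaches_refl)
  ultimately show ?case
    using reaches_trans by blast
qed (rule reaches_step, simp add: step_def reaches_refl)+

abbreviation halted :: "nat \<Rightarrow> bool" where
  "halted s \<equiv> snd (prod_decode s) = 0"

lemma funpow_step_halted:
  assumes "halted s"
  shows "(step p ^^ t) s = s"
  using assms by (induction t) (auto simp: step_def)

text \<open>A halted state never changes, so the result does not depend on when it is inspected
  after halting.\<close>

lemma funpow_step_eq:
  assumes "halted ((step p ^^ t) s)" "t \<le> t'"
  shows "(step p ^^ t') s = (step p ^^ t) s"
  using funpow_step_halted[OF assms(1), where t = "t' - t" and p = p] assms(2)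
  by (metis funpow_add comp_apply le_add_diff_inverse2)


section \<open>Delayed output of all machines at once\<close>

text \<open>\<open>prod_encode (j, n)\<close> equals \<open>cantor_pair n j\<close>: program
  \<open>n\<close> is asked for entry \<open>j\<close> of component \<open>n\<close>, the component
  with the program's own index.\<close>

definition initial_state :: "nat \<Rightarrow> nat \<Rightarrow> nat" where
  "initial_state n j = prod_encode (prod_encode (j, n), Suc (prod_encode (n, 0)))"

text \<open>The argument packs program index, current entry and machine state. A halted state is
  left after one tick for a fresh run on the next entry, so no entry is output twice.\<close>

definition advance :: "baire \<Rightarrow> nat \<Rightarrow> nat" where
  "advance p z =
    (let n = fst (prod_decode z); j = fst (prod_decode (snd (prod_decode z)));
       s = snd (prod_decode (snd (prod_decode z)))
     in if halted s then prod_encode (n, prod_encode (Suc j, initial_state n (Suc j)))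
       else prod_encode (n, prod_encode (j, step p s)))"

definition simulation :: "baire \<Rightarrow> nat \<Rightarrow> nat \<Rightarrow> nat" where
  "simulation p n k = (advance p ^^ k) (prod_encode (n, prod_encode (0, initial_state n 0)))"

text \<open>Whenever the simulated machine has not halted, the output is 0, which is ignored in a name
  of a point of a completion. Hence this function is total whatever the machines do.\<close>

definition delayed_output :: "baire \<Rightarrow> nat \<Rightarrow> nat" where
  "delayed_output p m =
    (let s = snd (prod_decode (snd (prod_decode
       (simulation p (snd (prod_decode m)) (fst (prod_decode m))))))
     in if halted s then Suc (fst (prod_decode s)) else 0)"

lemma computable_on_delayed_output: "computable_on S delayed_output"
proof -
  have "computable_on S (\<lambda>p z. advance p z)"
    unfolding advance_def Let_def initial_state_def
    by (intro computable_intros computable_on_step[THEN computable_on_comp])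
  then have "computable_on S (\<lambda>p m. delayed_output p m)"
    unfolding delayed_output_def Let_def simulation_def initial_state_def
    by (intro computable_intros) simp
  then show ?thesis
    by simp
qed

text \<open>The elements below \<open>enumerate S m\<close> are those of smaller index. This links
  the \<open>m\<close>-th output to the entry number \<open>m\<close>.\<close>

lemma card_less_enumerate:
  fixes S :: "nat set"
  assumes "infinite S"
  shows "card (S \<inter> {..<enumerate S m}) = m"
proof -
  have "S \<inter> {..<enumerate S m} = enumerate S ` {..<m}"
    using assms by (auto simp: enumerate_in_set dest!: enumerate_Ex[OF assms])
  then show ?thesis
    using inj_enumerate[OF assms] by (simp add: card_image inj_on_subset)
qed

text \<open>For the right program each entry is found after finitely many ticks, so infinitely many
  nonzero values occur, and the \<open>m\<close>-th of them is \<open>Suc (u m)\<close>.\<close>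

lemma minus_one_delayed_output:
  assumes run: "\<And>j. run c p (cantor_pair (code_encode c) j) = Some (u j)"
  shows "minus_one (component (delayed_output p) (code_encode c)) = Some u"
proof -
  define n where "n = code_encode c"
  define z where "z = component (delayed_output p) n"
  \<comment> \<open>\<open>S\<close> holds the output times, \<open>J k\<close> counts the outputs
    before time \<open>k\<close> and so is the entry in progress, and \<open>A k\<close> is the
    machine state at time \<open>k\<close>.\<close>
  define S where "S = {k. z k \<noteq> 0}"
  define J where "J k = card (S \<inter> {..<k})" for k
  define A where "A k = snd (prod_decode (snd (prod_decode (simulation p n k))))" for k
  have z: "z k = (if halted (A k) then Suc (fst (prod_decode (A k))) else 0)" for k
    by (simp add: z_def component_def cantor_pair_eq_prod_encode delayed_output_def A_def Let_def)
  then have S: "k \<in> S \<longleftrightarrow> halted (A k)" for k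
    by (simp add: S_def)
  have J_Suc: "J (Suc k) = (if k \<in> S then Suc (J k) else J k)" for k
    by (auto simp: J_def lessThan_Suc Int_insert_right)
  have inv: "\<exists>t. simulation p n k = prod_encode (n, prod_encode (J k, A k)) \<and>
      A k = (step p ^^ t) (initial_state n (J k))" for k
  proof (induction k)
    case 0
    then show ?case
      by (auto simp: simulation_def J_def A_def intro!: exI[of _ 0])
  next
    case (Suc k)
    then obtain t where sim: "simulation p n k = prod_encode (n, prod_encode (J k, A k))"
      and A: "A k = (step p ^^ t) (initial_state n (J k))" by blast
    have "simulation p n (Suc k) = advance p (simulation p n k)"
      by (simp add: simulation_def)
    then have sim': "simulation p n (Suc k) = prod_encode (n, prod_encode (J (Suc k),
        if k \<in> S then initial_state n (J (Suc k)) else step p (A k)))"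
      by (simp add: sim advance_def J_Suc S Let_def)
    then have A': "A (Suc k) = (if k \<in> S then initial_state n (J (Suc k)) else step p (A k))"
      by (simp add: A_def)
    have "A (Suc k) = (step p ^^ (if k \<in> S then 0 else Suc t)) (initial_state n (J (Suc k)))"
      by (simp add: A' A J_Suc)
    with sim' A' show ?case
      by metis
  qed
  have halts: "\<exists>t. (step p ^^ t) (initial_state n j) = prod_encode (u j, 0)" for j
    using reaches_run[OF run, of j 0] unfolding n_def initial_state_def reaches_def
    by (simp add: cantor_pair_eq_prod_encode)
  have val: "z k = Suc (u (J k))" if "k \<in> S" for k
  proof -
    obtain t where t: "A k = (step p ^^ t) (initial_state n (J k))"
      using inv by blast
    obtain t' where t': "(step p ^^ t') (initial_state n (J k)) = prod_encode (u (J k), 0)"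
      using halts by blast
    \<comment> \<open>After \<open>t\<close> steps the machine has halted, after \<open>t'\<close>
      steps it has the right result; both persist up to the maximum.\<close>
    have "(step p ^^ t) (initial_state n (J k)) = (step p ^^ max t t') (initial_state n (J k))"
      using that t S by (intro funpow_step_eq[symmetric]) auto
    also have "\<dots> = prod_encode (u (J k), 0)"
      using t' by (subst funpow_step_eq[of t' p]) auto
    finally show ?thesis
      using that t S by (simp add: z)
  qed
  \<comment> \<open>Without output from time \<open>k\<close> on, the run for entry
    \<open>J k\<close> would never be replaced, yet it halts within \<open>t'\<close> further
    ticks.\<close>
  have "\<exists>k'\<ge>k. k' \<in> S" for k
  proof (rule ccontr)
    assume "\<not> ?thesis"
    then have notin: "k + i \<notin> S" for i
      by simp
    obtain t where t: "A k = (step p ^^ t) (initial_state n (J k))"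
      using inv by blast
    obtain t' where t': "(step p ^^ t') (initial_state n (J k)) = prod_encode (u (J k), 0)"
      using halts by blast
    have "simulation p n (k + i) =
        prod_encode (n, prod_encode (J k, (step p ^^ (i + t)) (initial_state n (J k))))" for i
    proof (induction i)
      case 0
      show ?case
        using inv[of k] t by auto
    next
      case (Suc i)
      have "simulation p n (k + Suc i) = advance p (simulation p n (k + i))"
        by (simp add: simulation_def)
      moreover have "\<not> halted ((step p ^^ (i + t)) (initial_state n (J k)))"
        using notin[of i] Suc by (simp add: S A_def)
      ultimately show ?case
        by (simp add: Suc advance_def)
    qed
    then have "A (k + t') = (step p ^^ (t' + t)) (initial_state n (J k))"
      by (simp add: A_def)
    also have "\<dots> = prod_encode (u (J k), 0)"
      using t' by (subst funpow_step_eq[of t' p]) auto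
    finally show False
      using notin[of t'] by (simp add: S)
  qed
  then have inf: "infinite S"
    unfolding infinite_nat_iff_unbounded_le by blast
  then have "z (enumerate S m) - 1 = u m" for m
    using val[OF enumerate_in_set[OF inf]] card_less_enumerate[OF inf] by (simp add: J_def)
  with inf have "minus_one z = Some u"
    by (simp add: minus_one_def S_def)
  then show ?thesis
    by (simp add: z_def n_def)
qed


section \<open>Weihrauch reductions\<close>

text \<open>Realizers need not be computable, so choosing a name of some value for each instance is
  enough.\<close>

lemma realizer_exists:
  assumes "\<And>x. vals f x \<subseteq> ran (tgt f)"
  shows "\<exists>F. realizer F f"
proof -
  have "\<exists>q y. tgt f q = Some y \<and> y \<in> vals f x" if "x \<in> mv_dom f" for x
    using that assms by (fastforce simp: mv_dom_def ran_def)
  then obtain N where N: "\<And>x. x \<in> mv_dom f \<Longrightarrow> \<exists>y. tgt f (N x) = Some y \<and> y \<in> vals f x"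
    by metis
  have "realizer (\<lambda>p. map_option N (src f p)) f"
    using N by (auto simp: realizer_def)
  then show ?thesis
    by blast
qed

text \<open>A reduction works for all realizers, so a single answer can be prescribed. If
  \<open>p\<close> names no instance, \<open>r\<close> may even be \<open>None\<close>.\<close>

lemma realizer_fun_upd:
  assumes "realizer G f"
    and "\<And>x. src f p = Some x \<Longrightarrow> x \<in> mv_dom f \<Longrightarrow> \<exists>y. (tgt f \<circ>\<^sub>m (\<lambda>_. r)) p = Some y \<and> y \<in> vals f x"
  shows "realizer (G(p := r)) f"
  using assms by (auto simp: realizer_def map_comp_def)

lemma exists_component: "\<exists>p. \<forall>n. component p n = q n"
proof (intro exI allI)
  show "component (\<lambda>m. q (snd (prod_decode m)) (fst (prod_decode m))) n = q n" for n
    by (simp add: component_def cantor_pair_eq_prod_encode)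
qed

lemma seq_rep_eq_Some:
  "seq_rep \<delta> p = Some y \<longleftrightarrow> (\<forall>n. \<delta> (component p n) = Some (y n))"
  by (auto simp: seq_rep_def dom_def fun_eq_iff) (metis option.sel option.distinct(1))+

lemma ran_seq_rep: "y \<in> ran (seq_rep \<delta>) \<longleftrightarrow> (\<forall>n. y n \<in> ran \<delta>)"
proof
  assume "\<forall>n. y n \<in> ran \<delta>"
  then obtain q where q: "\<And>n. \<delta> (q n) = Some (y n)"
    unfolding ran_def mem_Collect_eq by metis
  obtain p where "\<And>n. component p n = q n"
    using exists_component[of q] by blast
  with q have "seq_rep \<delta> p = Some y"
    by (simp add: seq_rep_eq_Some)
  then show "y \<in> ran (seq_rep \<delta>)"
    by (auto simp: ran_def)
qed (auto simp: ran_def seq_rep_eq_Some)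

lemma realizer_stashing_exists: "\<exists>F. realizer F (stashing f)"
proof (rule realizer_exists)
  show "vals (stashing f) x \<subseteq> ran (tgt (stashing f))" for x
    by (auto simp: stashing_def ran_seq_rep)
qed

lemma computable_odd_part: "computable (\<lambda>p. Some (\<lambda>n. p (Suc (2 * n))))"
  unfolding computable_Some by (intro computable_intros)

section \<open>The two reductions\<close>

lemma upper_cone_weihrauch_le:
  assumes "is_problem f"
  shows "upper_cone f \<le>\<^sub>W f"
proof -
  \<comment> \<open>\<open>H\<close> returns the answer alone: a name of a value of \<open>f\<close>
    is reused as a name of its own Turing degree.\<close>
  let ?H = "\<lambda>p :: baire. Some (\<lambda>n. p (Suc (2 * n)))"
  have "realizer (?H \<circ>\<^sub>m (\<lambda>p. map_option (baire_pair p) ((G \<circ>\<^sub>m Some) p))) (upper_cone f)"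
    if G: "realizer G f" for G
    unfolding realizer_def
  proof (intro allI impI)
    fix p x
    assume p: "src (upper_cone f) p = Some x \<and> x \<in> mv_dom (upper_cone f)"
    then have "src f p = Some x" "x \<in> mv_dom f"
      using mv_dom_upper_cone[OF assms] by (auto simp: upper_cone_def)
    with G obtain q y where q: "G p = Some q" "tgt f q = Some y" "y \<in> vals f x"
      unfolding realizer_def map_comp_Some_iff by blast
    have "deg q \<in> vals (upper_cone f) x"
      using q turing_le_refl by (auto simp: upper_cone_def point_turing_le_def)
    with q show "\<exists>y. (tgt (upper_cone f) \<circ>\<^sub>m (?H \<circ>\<^sub>m (\<lambda>p. map_option (baire_pair p) ((G \<circ>\<^sub>m Some) p)))) p
        = Some y \<and> y \<in> vals (upper_cone f) x"
      by (simp add: upper_cone_def degree_rep_def baire_pair_right)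
  qed
  moreover have "computable Some"
    unfolding computable_Some using computable_on_oracle[OF computable_on_ident] by simp
  ultimately show ?thesis
    unfolding weihrauch_le_def using computable_odd_part by blast
qed

lemma weihrauch_le_upper_cone:
  assumes f: "is_problem f"
    and par: "parallelization f \<le>\<^sub>W f"
    and stash: "f \<le>\<^sub>W stashing f"
  shows "f \<le>\<^sub>W upper_cone f"
proof -
  obtain H1 K1 where "computable H1" "computable K1"
    and 1: "\<And>G. realizer G (stashing f) \<Longrightarrow>
      realizer (H1 \<circ>\<^sub>m (\<lambda>p. map_option (baire_pair p) ((G \<circ>\<^sub>m K1) p))) f"
    using stash unfolding weihrauch_le_def by blast
  obtain H2 K2 where "computable H2" "computable K2"
    and 2: "\<And>G. realizer G f \<Longrightarrow>
      realizer (H2 \<circ>\<^sub>m (\<lambda>p. map_option (baire_pair p) ((G \<circ>\<^sub>m K2) p))) (parallelization f)"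
    using par unfolding weihrauch_le_def by blast
  obtain F0 where F0: "realizer F0 f"
    using f by (auto simp: is_problem_def)
  obtain S0 where S0: "realizer S0 (stashing f)"
    using realizer_stashing_exists by blast
  \<comment> \<open>\<open>H1\<close> needs the original input next to the answer, so the input half
    is kept; the other half becomes the output of all guessed programs with oracle
    \<open>P\<close>.\<close>
  let ?M = "\<lambda>P. baire_pair (\<lambda>n. P (2 * n)) (delayed_output P)"
  define H where "H = H1 \<circ>\<^sub>m (\<lambda>P. Some (?M P))"
  have "computable_on UNIV ?M"
    by (intro computable_on_baire_pair computable_on_delayed_output computable_intros)
  then have "computable H"
    unfolding H_def using \<open>computable H1\<close> by (intro computable_map_comp) (simp_all only: computable_Some)
  have "realizer (H \<circ>\<^sub>m (\<lambda>p. map_option (baire_pair p) ((G \<circ>\<^sub>m (K2 \<circ>\<^sub>m K1)) p))) f"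
    if G: "realizer G (upper_cone f)" for G
    unfolding realizer_def
  proof (intro allI impI)
    fix p x0
    assume p: "src f p = Some x0 \<and> x0 \<in> mv_dom f"
    \<comment> \<open>\<open>S\<close> stays free so that \<open>S0\<close> as well as alterations
      of it at \<open>s\<close> can be inserted.\<close>
    have via_stashing: "\<exists>s r' w y. K1 p = Some s \<and> S s = Some r' \<and>
        H1 (baire_pair p r') = Some w \<and> tgt f w = Some y \<and> y \<in> vals f x0"
      if "realizer S (stashing f)" for S
      using 1[OF that] p by (fastforce simp: realizer_def map_comp_Some_iff)
    obtain s where s: "K1 p = Some s"
      using via_stashing[OF S0] by blast
    \<comment> \<open>If \<open>s\<close> named no instance, some realizer would be undefined at
      \<open>s\<close>, and the reduction would fail with it.\<close>
    have "\<exists>x. src (stashing f) s = Some x \<and> x \<in> mv_dom (stashing f)"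
    proof (rule ccontr)
      assume "\<not> ?thesis"
      then have "realizer (S0(s := None)) (stashing f)"
        using S0 by (intro realizer_fun_upd) auto
      from via_stashing[OF this] s show False
        by simp
    qed
    \<comment> \<open>Stashing and parallelization share the source representation and the domain,
      so \<open>s\<close> also names an instance of the parallelization.\<close>
    then obtain x where x: "src (parallelization f) s = Some x" "x \<in> mv_dom (parallelization f)"
      by (auto simp: mv_dom_stashing[OF f] mv_dom_parallelization)
        (simp add: stashing_def parallelization_def)
    have via_f: "\<exists>t r w y. K2 s = Some t \<and> F t = Some r \<and>
        H2 (baire_pair s r) = Some w \<and> tgt (parallelization f) w = Some y \<and>
        y \<in> vals (parallelization f) x"
      if "realizer F f" for F
      using 2[OF that] x by (fastforce simp: realizer_def map_comp_Some_iff)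
    obtain t where t: "K2 s = Some t"
      using via_f[OF F0] by blast
    have "\<exists>x'. src f t = Some x' \<and> x' \<in> mv_dom f"
    proof (rule ccontr)
      assume "\<not> ?thesis"
      then have "realizer (F0(t := None)) f"
        using F0 by (intro realizer_fun_upd) auto
      from via_f[OF this] t show False
        by simp
    qed
    then obtain x' where x': "src f t = Some x'" "x' \<in> mv_dom f"
      by blast
    then have "src (upper_cone f) t = Some x' \<and> x' \<in> mv_dom (upper_cone f)"
      using mv_dom_upper_cone[OF f] by (simp add: upper_cone_def)
    with G obtain q where q: "G t = Some q" "deg q \<in> vals (upper_cone f) x'"
      unfolding realizer_def by (fastforce simp: map_comp_Some_iff upper_cone_def degree_rep_def)
    \<comment> \<open>Membership in the cone is witnessed by some \<open>q'\<close> of the same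
      degree, which may differ from \<open>q\<close>.\<close>
    then obtain q' y' where "deg q = deg q'" "point_turing_le (tgt f) y' q'" "y' \<in> vals f x'"
      by (auto simp: upper_cone_def)
    moreover from \<open>deg q = deg q'\<close> have "q' \<le>\<^sub>T q"
      using turing_le_refl by (auto simp: deg_def turing_equiv_def set_eq_iff)
    ultimately obtain r where r: "tgt f r = Some y'" "y' \<in> vals f x'" "r \<le>\<^sub>T q"
      unfolding point_turing_le_def using turing_le_trans by blast
    \<comment> \<open>\<open>r\<close> is obtained from \<open>q\<close> without uniformity, but
      some realizer of \<open>f\<close> answers \<open>t\<close> with \<open>r\<close>, and then
      \<open>H2\<close> must yield a name \<open>w\<close> of solutions for all instances.\<close>
    have "realizer (F0(t := Some r)) f"
      using F0 r x' by (intro realizer_fun_upd) auto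
    from via_f[OF this] t obtain w y where w: "H2 (baire_pair s r) = Some w"
      "tgt (parallelization f) w = Some y" "y \<in> vals (parallelization f) x"
      by auto
    \<comment> \<open>This is exactly what \<open>H\<close> receives. It computes \<open>w\<close>
      by some code \<open>c\<close>, whose index is the right guess.\<close>
    let ?P = "baire_pair p q"
    have "s \<le>\<^sub>T ?P"
      using computable_imp_turing_le[OF \<open>computable K1\<close>, OF s] turing_le_baire_pair_left
      by (rule turing_le_trans)
    moreover have "r \<le>\<^sub>T ?P"
      using r(3) turing_le_baire_pair_right by (rule turing_le_trans)
    ultimately have "baire_pair s r \<le>\<^sub>T ?P"
      by (rule turing_le_baire_pair)
    with computable_imp_turing_le[OF \<open>computable H2\<close>, OF w(1)] have "w \<le>\<^sub>T ?P"
      by (rule turing_le_trans)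
    then obtain c where c: "computes c ?P w"
      unfolding turing_le_def by blast
    define n where "n = code_encode c"
    have "minus_one (component (delayed_output ?P) n) = Some (component w n)"
      unfolding n_def using c by (intro minus_one_delayed_output) (simp only: computes_def component_def)
    then have n: "completion_rep (tgt f) (component (delayed_output ?P) n) = Some (Proper (y n))"
      "y n \<in> vals f (x n)"
      using w(2,3) by (simp_all add: completion_rep_def parallelization_def seq_rep_eq_Some)
    \<comment> \<open>At wrong guesses the output still names a point, possibly
      \<open>Bottom\<close>, because \<open>completion_rep\<close> is total; so \<open>the\<close>
      always meets a \<open>Some\<close>.\<close>
    define v where "v i = the (completion_rep (tgt f) (component (delayed_output ?P) i))" for i
    have v: "completion_rep (tgt f) (component (delayed_output ?P) i) = Some (v i)" for i
      by (simp add: v_def completion_rep_def)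
    have "v i \<in> ran (completion_rep (tgt f))" for i
      using v[of i] by (auto simp: ran_def)
    moreover have "v n \<in> Proper ` vals f (x n)"
      using n v[of n] by simp
    moreover have "\<forall>i. x i \<in> mv_dom f"
      using x(2) by (simp add: mv_dom_parallelization)
    ultimately have "v \<in> vals (stashing f) x"
      by (auto simp: stashing_def)
    moreover have "tgt (stashing f) (delayed_output ?P) = Some v"
      using v by (simp add: stashing_def seq_rep_eq_Some)
    moreover have "src (stashing f) s = Some x"
      using x(1) by (simp add: stashing_def parallelization_def)
    \<comment> \<open>\<open>delayed_output ?P\<close> is a legitimate answer to \<open>s\<close>,
      so a realizer giving it shows that \<open>H1\<close> succeeds on what \<open>H\<close> feeds
      it.\<close>
    ultimately have "realizer (S0(s := Some (delayed_output ?P))) (stashing f)"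
      using S0 by (intro realizer_fun_upd) auto
    from via_stashing[OF this] s
    obtain u z where "H1 (baire_pair p (delayed_output ?P)) = Some u" "tgt f u = Some z" "z \<in> vals f x0"
      by auto
    with s t q show "\<exists>y. (tgt f \<circ>\<^sub>m
        (H \<circ>\<^sub>m (\<lambda>p. map_option (baire_pair p) ((G \<circ>\<^sub>m (K2 \<circ>\<^sub>m K1)) p)))) p = Some y \<and> y \<in> vals f x0"
      by (simp add: H_def baire_pair_left)
  qed
  moreover have "computable (K2 \<circ>\<^sub>m K1)"
    using \<open>computable K1\<close> \<open>computable K2\<close> by (intro computable_map_comp)
  ultimately show ?thesis
    unfolding weihrauch_le_def using \<open>computable H\<close> by blast
qed

theorem corollary1p16:
  fixes f :: "('a, 'b) mvfun"
  assumes "is_problem f"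
    and "f \<equiv>\<^sub>W parallelization f"
    and "f \<equiv>\<^sub>W stashing f"
  shows "f \<equiv>\<^sub>W upper_cone f"
  using assms weihrauch_le_upper_cone upper_cone_weihrauch_le
  unfolding weihrauch_equiv_def by blast

end
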